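(* In the non-deterministic $\lambda$-calculus $\Lambda_\oplus$ the following hold: (1) $\to_\oplus$ satisfies head factorization: $\to_\oplus^*\subseteq\to_{\mathsf h\oplus}^*\cdot\to_{\neg\mathsf h\oplus}^*$; (2) $\to_{\neg\mathsf h\beta}\cdot\mapsto_\oplus\ \subseteq\ \to_{\mathsf h\oplus}\cdot\to_\beta^=$; (3) $\mapsto_\oplus$ is substitutive. Consequently $\to_\beta\cup\to_\oplus$ satisfies head factorization: $(\to_\beta\cup\to_\oplus)^*\subseteq(\to_{\mathsf h\beta}\cup\to_{\mathsf h\oplus})^*\cdot(\to_{\neg\mathsf h\beta}\cup\to_{\neg\mathsf h\oplus})^*$.
   Context: Terms of $\Lambda_\oplus$: $t::=x\mid\oplus\mid\lambda x.t\mid tt$, where $\oplus$ is a constant; modulo $\alpha$-equivalence, with capture-avoiding substitution $t\{x:=q\}$. Contexts: $C::=\langle\cdot\rangle\mid tC\mid Ct\mid\lambda x.C$. The contextual closure $\to_\rho$ of a root relation $\mapsto_\rho$: $C\langle r\rangle\to_\rho C\langle r'\rangle$ for $r\mapsto_\rho r'$. Rules: $(\lambda x.p)q\mapsto_\beta p\{x:=q\}$; $\oplus tp\mapsto_\oplus t$ and $\oplus tp\mapsto_\oplus p$. Head contexts: $H::=\lambda x_1\dots\lambda x_k.\langle\cdot\rangle t_1\dots t_n$ ($k,n\ge0$); non-head contexts are the other contexts. $\to_{\mathsf h\rho}$ (resp. $\to_{\neg\mathsf h\rho}$) is the closure of $\mapsto_\rho$ under head (resp. non-head) contexts. A root relation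 $\mapsto$ is substitutive if $r\mapsto r'$ implies $r\{x:=q\}\mapsto r'\{x:=q\}$ for all $x,q$. $\to^*$, $\to^=$ denote reflexive-transitive and reflexive closure; $R\cdot S$ is composition. *)

theory Defs
  imports Main
begin

text \<open>
  Terms modulo \<open>\<alpha>\<close>-equivalence are represented by de Bruijn terms: below \<open>d\<close> binders, the index
  \<open>d + x\<close> denotes the free variable \<open>x\<close>.
\<close>

datatype trm = Var nat | Oplus | Lam trm | App trm trm

primrec rename :: "(nat \<Rightarrow> nat) \<Rightarrow> trm \<Rightarrow> trm" where
  "rename f (Var x) = Var (f x)"
| "rename f Oplus = Oplus"
| "rename f (Lam t) = Lam (rename (case_nat 0 (Suc \<circ> f)) t)"
| "rename f (App t u) = App (rename f t) (rename f u)"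

text \<open>
  Simultaneous capture-avoiding substitution of \<open>s x\<close> for every free variable \<open>x\<close>; under a binder,
  the bound variable is kept and the substituted terms are shifted.
\<close>

primrec subst :: "(nat \<Rightarrow> trm) \<Rightarrow> trm \<Rightarrow> trm" where
  "subst s (Var x) = s x"
| "subst s Oplus = Oplus"
| "subst s (Lam t) = Lam (subst (case_nat (Var 0) (rename Suc \<circ> s)) t)"
| "subst s (App t u) = App (subst s t) (subst s u)"

text \<open>
  \<open>t{x:=q}\<close> for a free variable \<open>x\<close>: all other free variables are left unchanged.
\<close>

definition subst_var :: "trm \<Rightarrow> nat \<Rightarrow> trm \<Rightarrow> trm" where
  "subst_var t x q = subst (Var(x := q)) t"

text \<open>
  \<open>p{x:=q}\<close> where \<open>p\<close> is the body of an abstraction \<open>\<lambda>x.p\<close>: index \<open>0\<close> of \<open>p\<close> is replaced by \<open>q\<close>,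
  and index \<open>Suc y\<close> of \<open>p\<close> denotes the variable \<open>y\<close> outside the removed binder.
\<close>

definition subst_bound :: "trm \<Rightarrow> trm \<Rightarrow> trm" where
  "subst_bound p q = subst (case_nat q Var) p"

datatype ctx = Hole | CAppR trm ctx | CAppL ctx trm | CLam ctx

text \<open>Filling the hole may capture variables, so no shifting takes place.\<close>

primrec plug :: "ctx \<Rightarrow> trm \<Rightarrow> trm" where
  "plug Hole r = r"
| "plug (CAppR t C) r = App t (plug C r)"
| "plug (CAppL C t) r = App (plug C r) t"
| "plug (CLam C) r = Lam (plug C r)"

definition head_ctx :: "ctx \<Rightarrow> bool" where
  "head_ctx H \<longleftrightarrow> (\<exists>k ts. H = (CLam ^^ k) (foldl CAppL Hole ts))"

definition closure_under :: "(ctx \<Rightarrow> bool) \<Rightarrow> trm rel \<Rightarrow> trm rel" where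
  "closure_under P R = {(plug C r, plug C r') | C r r'. P C \<and> (r, r') \<in> R}"

definition ctx_closure :: "trm rel \<Rightarrow> trm rel" where
  "ctx_closure R = closure_under (\<lambda>C. True) R"

definition head_closure :: "trm rel \<Rightarrow> trm rel" where
  "head_closure R = closure_under head_ctx R"

definition nonhead_closure :: "trm rel \<Rightarrow> trm rel" where
  "nonhead_closure R = closure_under (\<lambda>C. \<not> head_ctx C) R"

inductive_set beta_root :: "trm rel" where
  "(App (Lam p) q, subst_bound p q) \<in> beta_root"

inductive_set oplus_root :: "trm rel" where
  oplus_left: "(App (App Oplus t) p, t) \<in> oplus_root"
| oplus_right: "(App (App Oplus t) p, p) \<in> oplus_root"

definition substitutive :: "trm rel \<Rightarrow> bool" where
  "substitutive R \<longleftrightarrow>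
     (\<forall>r r' x q. (r, r') \<in> R \<longrightarrow> (subst_var r x q, subst_var r' x q) \<in> R)"

end

theory Submission
  imports Defs
begin

text \<open>
  Following Loader and Kashima, call \<open>m\<close> standardly reducible to \<open>n\<close> if weak head steps (steps in
  contexts \<open>\<langle>\<cdot>\<rangle> t\<^sub>1 \<dots> t\<^sub>n\<close>) lead from \<open>m\<close> to a term with the same outermost constructor as \<open>n\<close>, whose
  immediate subterms are in turn standardly reducible to those of \<open>n\<close>. This relation is stable under
  substitution, and it absorbs a root \<open>\<beta>\<close>- or \<open>\<oplus>\<close>-step on the right: the redex already shows up
  after weak head steps on the left. Hence it contains all reduction sequences. Reading a standard
  reduction from the outside in, the weak head steps come first. If \<open>n\<close> is not an abstraction, the
  remaining steps are non-head; if it is, one recurses into its body. The argument is uniform in the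
  root relation, so it covers both \<open>\<oplus>\<close> alone and \<open>\<beta> \<union> \<oplus>\<close>.
\<close>

lemma rtrancl_map:
  assumes "\<And>t u. (t, u) \<in> R \<Longrightarrow> (f t, f u) \<in> S" and "(t, u) \<in> R\<^sup>*"
  shows "(f t, f u) \<in> S\<^sup>*"
  using assms(2) by induction (auto intro: assms(1) rtrancl_into_rtrancl)

section \<open>Substitution\<close>

abbreviation lift_rename :: "(nat \<Rightarrow> nat) \<Rightarrow> nat \<Rightarrow> nat" where
  "lift_rename f \<equiv> case_nat 0 (Suc \<circ> f)"

abbreviation lift_subst :: "(nat \<Rightarrow> trm) \<Rightarrow> nat \<Rightarrow> trm" where
  "lift_subst s \<equiv> case_nat (Var 0) (rename Suc \<circ> s)"

lemma rename_eq_subst: "rename f t = subst (Var \<circ> f) t"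
proof (induction t arbitrary: f)
  case (Lam t)
  have "Var \<circ> lift_rename f = lift_subst (Var \<circ> f)"
    by (auto split: nat.split)
  then show ?case by (simp only: rename.simps subst.simps Lam.IH)
qed auto

lemma subst_Var: "subst Var t = t"
proof (induction t)
  case (Lam t)
  have "lift_subst Var = Var"
    by (auto split: nat.split)
  then show ?case by (simp only: subst.simps Lam.IH)
qed auto

lemma subst_rename: "subst s (rename f t) = subst (s \<circ> f) t"
proof (induction t arbitrary: s f)
  case (Lam t)
  have "lift_subst s \<circ> lift_rename f = lift_subst (s \<circ> f)"
    by (auto split: nat.split)
  then show ?case by (simp only: rename.simps subst.simps Lam.IH)
qed auto

lemma rename_rename: "rename g (rename f t) = rename (g \<circ> f) t"
  by (simp add: rename_eq_subst[of g] rename_eq_subst[of "g \<circ> f"] subst_rename comp_assoc)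

lemma rename_subst: "rename f (subst s t) = subst (rename f \<circ> s) t"
proof (induction t arbitrary: s f)
  case (Lam t)
  have "rename (lift_rename f) \<circ> lift_subst s = lift_subst (rename f \<circ> s)"
    by (auto split: nat.split simp: rename_rename comp_def)
  then show ?case by (simp only: rename.simps subst.simps Lam.IH)
qed auto

lemma subst_subst: "subst s (subst s' t) = subst (subst s \<circ> s') t"
proof (induction t arbitrary: s s')
  case (Lam t)
  have "subst (lift_subst s) \<circ> lift_subst s' = lift_subst (subst s \<circ> s')"
    by (auto split: nat.split simp: subst_rename rename_subst comp_def)
  then show ?case by (simp only: subst.simps Lam.IH)
qed auto

lemma subst_subst_bound:
  "subst s (subst_bound p q) = subst_bound (subst (lift_subst s) p) (subst s q)"
proof -
  have "subst s \<circ> case_nat q Var = subst (case_nat (subst s q) Var) \<circ> lift_subst s"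
    by (auto split: nat.split simp: subst_rename comp_def subst_Var)
  then show ?thesis
    by (simp add: subst_bound_def subst_subst)
qed

text \<open>
  Substitutivity is needed for simultaneous substitutions, because neither lifting under a binder
  nor \<^const>\<open>subst_bound\<close> stays within those of the form \<open>Var(x := q)\<close>.
\<close>

definition subst_closed :: "trm rel \<Rightarrow> bool" where
  "subst_closed R \<longleftrightarrow> (\<forall>t u s. (t, u) \<in> R \<longrightarrow> (subst s t, subst s u) \<in> R)"

lemma subst_closedI: "(\<And>t u s. (t, u) \<in> R \<Longrightarrow> (subst s t, subst s u) \<in> R) \<Longrightarrow> subst_closed R"
  by (simp add: subst_closed_def)

lemma subst_closedD: "subst_closed R \<Longrightarrow> (t, u) \<in> R \<Longrightarrow> (subst s t, subst s u) \<in> R"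
  by (simp add: subst_closed_def)

lemma subst_closed_imp_substitutive: "subst_closed R \<Longrightarrow> substitutive R"
  by (simp add: subst_closed_def substitutive_def subst_var_def)

lemma subst_closed_Un: "subst_closed R \<Longrightarrow> subst_closed S \<Longrightarrow> subst_closed (R \<union> S)"
  by (auto simp: subst_closed_def)

lemma subst_closed_rtrancl: "subst_closed R \<Longrightarrow> subst_closed (R\<^sup>*)"
  by (rule subst_closedI, rule rtrancl_map) (rule subst_closedD)

lemma subst_closed_beta_root: "subst_closed beta_root"
  by (rule subst_closedI)
    (auto simp: subst_subst_bound elim!: beta_root.cases intro: beta_root.intros)

lemma subst_closed_oplus_root: "subst_closed oplus_root"
  by (rule subst_closedI) (auto elim!: oplus_root.cases intro: oplus_root.intros)

section \<open>Contexts and closures\<close>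

primrec weak_head_ctx :: "ctx \<Rightarrow> bool" where
  "weak_head_ctx Hole = True"
| "weak_head_ctx (CAppR t C) = False"
| "weak_head_ctx (CAppL C t) = weak_head_ctx C"
| "weak_head_ctx (CLam C) = False"

lemma weak_head_ctx_foldl: "weak_head_ctx (foldl CAppL Hole ts)"
  by (induction ts rule: rev_induct) auto

lemma weak_head_ctxE:
  assumes "weak_head_ctx C"
  obtains ts where "C = foldl CAppL Hole ts"
proof -
  have "\<exists>ts. C = foldl CAppL Hole ts"
    using assms
  proof (induction C)
    case Hole
    have "Hole = foldl CAppL Hole []" by simp
    then show ?case by blast
  next
    case (CAppL C t)
    then obtain ts where "C = foldl CAppL Hole ts" by auto
    then have "CAppL C t = foldl CAppL Hole (ts @ [t])" by simp
    then show ?case by blast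
  qed auto
  with that show ?thesis by blast
qed

lemma head_ctx_unfold: "head_ctx C \<longleftrightarrow> weak_head_ctx C \<or> (\<exists>D. C = CLam D \<and> head_ctx D)"
proof
  assume "head_ctx C"
  then obtain k ts where "C = (CLam ^^ k) (foldl CAppL Hole ts)"
    by (auto simp: head_ctx_def)
  then show "weak_head_ctx C \<or> (\<exists>D. C = CLam D \<and> head_ctx D)"
    by (cases k) (auto simp: head_ctx_def weak_head_ctx_foldl)
next
  assume "weak_head_ctx C \<or> (\<exists>D. C = CLam D \<and> head_ctx D)"
  then obtain k ts where "C = (CLam ^^ k) (foldl CAppL Hole ts)"
  proof (elim disjE exE conjE)
    assume "weak_head_ctx C"
    then obtain ts where "C = (CLam ^^ 0) (foldl CAppL Hole ts)"
      by (auto elim: weak_head_ctxE)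
    then show ?thesis by (rule that)
  next
    fix D
    assume "C = CLam D" and "head_ctx D"
    then obtain k ts where "C = (CLam ^^ Suc k) (foldl CAppL Hole ts)"
      by (auto simp: head_ctx_def)
    then show ?thesis by (rule that)
  qed
  then show "head_ctx C"
    by (auto simp: head_ctx_def)
qed

lemma head_ctx_simps [simp]:
  "head_ctx Hole"
  "\<not> head_ctx (CAppR t C)"
  "head_ctx (CAppL C t) \<longleftrightarrow> weak_head_ctx C"
  "head_ctx (CLam C) \<longleftrightarrow> head_ctx C"
  by (subst head_ctx_unfold; simp)+

lemma weak_head_ctx_imp_head_ctx: "weak_head_ctx C \<Longrightarrow> head_ctx C"
  by (subst head_ctx_unfold) (rule disjI1)

lemma closure_underI: "P C \<Longrightarrow> (r, r') \<in> R \<Longrightarrow> (plug C r, plug C r') \<in> closure_under P R"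
  by (auto simp: closure_under_def)

lemma closure_underE:
  assumes "(t, u) \<in> closure_under P R"
  obtains C r r' where "t = plug C r" "u = plug C r'" "P C" "(r, r') \<in> R"
  using assms by (auto simp: closure_under_def)

lemma root_in_closure_under: "P Hole \<Longrightarrow> (t, u) \<in> R \<Longrightarrow> (t, u) \<in> closure_under P R"
  using closure_underI[of P Hole] by simp

lemma closure_under_mono: "(\<And>C. P C \<Longrightarrow> Q C) \<Longrightarrow> closure_under P R \<subseteq> closure_under Q R"
  by (auto simp: closure_under_def)

lemma closure_under_Un: "closure_under P (R \<union> S) = closure_under P R \<union> closure_under P S"
  by (auto simp: closure_under_def)

lemma closure_under_image:
  assumes "(t, u) \<in> closure_under P R"
    and "\<And>C. P C \<Longrightarrow> Q (F C)" "\<And>C r. plug (F C) r = f (plug C r)"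
  shows "(f t, f u) \<in> closure_under Q R"
  using assms(1)
proof (rule closure_underE)
  fix C r r'
  assume "t = plug C r" "u = plug C r'" "P C" "(r, r') \<in> R"
  then show ?thesis
    using closure_underI[of Q "F C" r r' R] assms(2,3) by simp
qed

lemma closure_under_steps_image:
  assumes "(t, u) \<in> (closure_under P R)\<^sup>*"
    and "\<And>C. P C \<Longrightarrow> Q (F C)" "\<And>C r. plug (F C) r = f (plug C r)"
  shows "(f t, f u) \<in> (closure_under Q R)\<^sup>*"
proof (rule rtrancl_map[where f = f, OF _ assms(1)])
  show "(f t, f u) \<in> closure_under Q R" if "(t, u) \<in> closure_under P R" for t u
    using that assms(2,3) by (rule closure_under_image)
qed

definition weak_head_closure :: "trm rel \<Rightarrow> trm rel" where
  "weak_head_closure R = closure_under weak_head_ctx R"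

definition nonweak_head_closure :: "trm rel \<Rightarrow> trm rel" where
  "nonweak_head_closure R = closure_under (\<lambda>C. \<not> weak_head_ctx C) R"

lemma root_in_weak_head_closure: "(t, u) \<in> R \<Longrightarrow> (t, u) \<in> weak_head_closure R"
  by (simp add: weak_head_closure_def root_in_closure_under)

lemma weak_head_step_AppL:
  "(t, u) \<in> weak_head_closure R \<Longrightarrow> (App t q, App u q) \<in> weak_head_closure R"
  unfolding weak_head_closure_def
  by (rule closure_under_image[where F = "\<lambda>C. CAppL C q"]) auto

lemma weak_head_steps_AppL:
  "(t, u) \<in> (weak_head_closure R)\<^sup>* \<Longrightarrow> (App t q, App u q) \<in> (weak_head_closure R)\<^sup>*"
  by (rule rtrancl_map[OF weak_head_step_AppL])

lemma nonweak_head_steps_AppL: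
  "(t, u) \<in> (nonweak_head_closure R)\<^sup>* \<Longrightarrow> (App t q, App u q) \<in> (nonweak_head_closure R)\<^sup>*"
  unfolding nonweak_head_closure_def
  by (rule closure_under_steps_image[where F = "\<lambda>C. CAppL C q"]) auto

lemma nonweak_head_steps_AppR:
  "(t, u) \<in> (ctx_closure R)\<^sup>* \<Longrightarrow> (App p t, App p u) \<in> (nonweak_head_closure R)\<^sup>*"
  unfolding nonweak_head_closure_def ctx_closure_def
  by (rule closure_under_steps_image[where F = "CAppR p"]) auto

lemma nonweak_head_steps_Lam:
  "(t, u) \<in> (ctx_closure R)\<^sup>* \<Longrightarrow> (Lam t, Lam u) \<in> (nonweak_head_closure R)\<^sup>*"
  unfolding nonweak_head_closure_def ctx_closure_def
  by (rule closure_under_steps_image[where F = CLam]) auto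

lemma head_steps_Lam: "(t, u) \<in> (head_closure R)\<^sup>* \<Longrightarrow> (Lam t, Lam u) \<in> (head_closure R)\<^sup>*"
  unfolding head_closure_def by (rule closure_under_steps_image[where F = CLam]) auto

lemma nonhead_steps_Lam:
  "(t, u) \<in> (nonhead_closure R)\<^sup>* \<Longrightarrow> (Lam t, Lam u) \<in> (nonhead_closure R)\<^sup>*"
  unfolding nonhead_closure_def by (rule closure_under_steps_image[where F = CLam]) auto

lemma subst_closed_weak_head_closure:
  assumes "subst_closed R"
  shows "subst_closed (weak_head_closure R)"
proof (rule subst_closedI)
  fix t u s
  assume "(t, u) \<in> weak_head_closure R"
  then obtain C r r' where plug: "t = plug C r" "u = plug C r'"
    and "weak_head_ctx C" and root: "(r, r') \<in> R"
    unfolding weak_head_closure_def by (rule closure_underE)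
  from \<open>weak_head_ctx C\<close> show "(subst s t, subst s u) \<in> weak_head_closure R"
    unfolding plug
  proof (induction C)
    case Hole
    show ?case
      using subst_closedD[OF assms root] by (simp add: root_in_weak_head_closure)
  next
    case (CAppL C q)
    then show ?case by (simp add: weak_head_step_AppL)
  qed auto
qed

lemma weak_head_closure_subset_head_closure: "weak_head_closure R \<subseteq> head_closure R"
  unfolding weak_head_closure_def head_closure_def
  by (rule closure_under_mono) (rule weak_head_ctx_imp_head_ctx)

lemma nonhead_closure_subset_nonweak_head_closure: "nonhead_closure R \<subseteq> nonweak_head_closure R"
  unfolding nonweak_head_closure_def nonhead_closure_def
  by (rule closure_under_mono) (blast intro: weak_head_ctx_imp_head_ctx)

lemma weak_head_nonweak_head_steps_subset_ctx_steps:
  "(weak_head_closure R)\<^sup>* O (nonweak_head_closure R)\<^sup>* \<subseteq> (ctx_closure R)\<^sup>*"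
proof -
  have "(weak_head_closure R)\<^sup>* O (nonweak_head_closure R)\<^sup>*
      \<subseteq> (ctx_closure R)\<^sup>* O (ctx_closure R)\<^sup>*"
    unfolding weak_head_closure_def nonweak_head_closure_def ctx_closure_def
    by (intro relcomp_mono rtrancl_mono closure_under_mono TrueI)
  then show ?thesis by simp
qed

section \<open>Standard reduction\<close>

inductive_set std :: "trm rel \<Rightarrow> trm rel" for R where
  std_Var: "(m, Var x) \<in> (weak_head_closure R)\<^sup>* \<Longrightarrow> (m, Var x) \<in> std R"
| std_Oplus: "(m, Oplus) \<in> (weak_head_closure R)\<^sup>* \<Longrightarrow> (m, Oplus) \<in> std R"
| std_Lam: "(m, Lam p) \<in> (weak_head_closure R)\<^sup>* \<Longrightarrow> (p, p') \<in> std R \<Longrightarrow> (m, Lam p') \<in> std R"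
| std_App: "(m, App p q) \<in> (weak_head_closure R)\<^sup>* \<Longrightarrow> (p, p') \<in> std R \<Longrightarrow> (q, q') \<in> std R
    \<Longrightarrow> (m, App p' q') \<in> std R"

inductive_cases std_OplusE: "(m, Oplus) \<in> std R"
inductive_cases std_LamE: "(m, Lam p) \<in> std R"
inductive_cases std_AppE: "(m, App p q) \<in> std R"

lemma std_refl: "(t, t) \<in> std R"
  by (induction t) (auto intro: std.intros)

lemma weak_head_steps_std: "(m, n) \<in> (weak_head_closure R)\<^sup>* \<Longrightarrow> (n, p) \<in> std R \<Longrightarrow> (m, p) \<in> std R"
  by (erule std.cases) (auto intro: std.intros rtrancl_trans)

text \<open>Quantifying over all renamings makes the hypothesis on \<open>s\<close> and \<open>s'\<close> survive lifting.\<close>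

lemma std_subst_if_std_renamed:
  assumes "subst_closed R" and "(m, m') \<in> std R"
    and "\<And>f x. (rename f (s x), rename f (s' x)) \<in> std R"
  shows "(subst s m, subst s' m') \<in> std R"
  using assms(2,3)
proof (induction arbitrary: s s')
  note weak_head_steps_subst =
    subst_closedD[OF subst_closed_rtrancl[OF subst_closed_weak_head_closure[OF assms(1)]]]
  {
    case (std_Var m x)
    have "(s x, s' x) \<in> std R"
      using std_Var.prems[of id x] by (simp add: rename_eq_subst subst_Var comp_def)
    then show ?case
      using weak_head_steps_subst[OF std_Var.hyps, of s] by (auto intro: weak_head_steps_std)
  next
    case (std_Oplus m)
    then show ?case
      using weak_head_steps_subst[OF std_Oplus.hyps, of s] by (auto intro: std.intros)
  next
    case (std_Lam m p p')
    have "(rename f (lift_subst s x), rename f (lift_subst s' x)) \<in> std R" for f x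
      using std_Lam.prems by (auto simp: rename_rename std_refl split: nat.split)
    then have "(subst (lift_subst s) p, subst (lift_subst s') p') \<in> std R"
      by (rule std_Lam.IH)
    then show ?case
      using weak_head_steps_subst[OF std_Lam.hyps(1), of s] by (auto intro: std.intros)
  next
    case (std_App m p q p' q')
    then show ?case
      using weak_head_steps_subst[OF std_App.hyps(1), of s] by (auto intro: std.intros)
  }
qed

lemma std_rename:
  assumes "subst_closed R" "(m, m') \<in> std R"
  shows "(rename f m, rename f m') \<in> std R"
  unfolding rename_eq_subst by (intro std_subst_if_std_renamed assms std_refl)

lemma std_subst:
  assumes "subst_closed R" "(m, m') \<in> std R" "\<And>x. (s x, s' x) \<in> std R"
  shows "(subst s m, subst s' m') \<in> std R"
  by (intro std_subst_if_std_renamed std_rename assms)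

lemma std_subst_bound:
  assumes "subst_closed R" "(p, p') \<in> std R" "(q, q') \<in> std R"
  shows "(subst_bound p q, subst_bound p' q') \<in> std R"
  unfolding subst_bound_def
  by (rule std_subst[OF assms(1,2)]) (auto intro: std_refl assms split: nat.split)

lemma std_beta_redexE:
  assumes "(m, App (Lam p') q') \<in> std R"
  obtains p q where "(m, App (Lam p) q) \<in> (weak_head_closure R)\<^sup>*"
    "(p, p') \<in> std R" "(q, q') \<in> std R"
proof -
  from assms obtain a q where "(m, App a q) \<in> (weak_head_closure R)\<^sup>*"
    and "(a, Lam p') \<in> std R" and arg: "(q, q') \<in> std R"
    by (rule std_AppE)
  moreover from this(2) obtain p where "(a, Lam p) \<in> (weak_head_closure R)\<^sup>*"
    and body: "(p, p') \<in> std R"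
    by (rule std_LamE)
  ultimately have "(m, App (Lam p) q) \<in> (weak_head_closure R)\<^sup>*"
    by (meson weak_head_steps_AppL rtrancl_trans)
  with body arg that show ?thesis by blast
qed

lemma std_oplus_redexE:
  assumes "(m, App (App Oplus p') q') \<in> std R"
  obtains p q where "(m, App (App Oplus p) q) \<in> (weak_head_closure R)\<^sup>*"
    "(p, p') \<in> std R" "(q, q') \<in> std R"
proof -
  from assms obtain a q where "(m, App a q) \<in> (weak_head_closure R)\<^sup>*"
    and "(a, App Oplus p') \<in> std R" and right: "(q, q') \<in> std R"
    by (rule std_AppE)
  moreover from this(2) obtain b p where "(a, App b p) \<in> (weak_head_closure R)\<^sup>*"
    and "(b, Oplus) \<in> std R" and left: "(p, p') \<in> std R"
    by (rule std_AppE)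
  moreover from this(2) have "(b, Oplus) \<in> (weak_head_closure R)\<^sup>*"
    by (rule std_OplusE)
  ultimately have "(m, App (App Oplus p) q) \<in> (weak_head_closure R)\<^sup>*"
    by (meson weak_head_steps_AppL rtrancl_trans)
  with left right that show ?thesis by blast
qed

lemma std_absorbs_beta_root:
  assumes "subst_closed R" "beta_root \<subseteq> R"
  shows "std R O beta_root \<subseteq> std R"
proof (rule subrelI)
  fix m u
  assume "(m, u) \<in> std R O beta_root"
  then obtain p' q' where "(m, App (Lam p') q') \<in> std R" and u: "u = subst_bound p' q'"
    by (auto elim: beta_root.cases)
  from this(1) obtain p q where redex: "(m, App (Lam p) q) \<in> (weak_head_closure R)\<^sup>*"
    and "(p, p') \<in> std R" "(q, q') \<in> std R"
    by (rule std_beta_redexE)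
  then have "(subst_bound p q, u) \<in> std R"
    unfolding u by (intro std_subst_bound assms(1))
  moreover have "(App (Lam p) q, subst_bound p q) \<in> weak_head_closure R"
    using assms(2) by (auto intro: root_in_weak_head_closure beta_root.intros)
  ultimately show "(m, u) \<in> std R"
    using redex by (blast intro: weak_head_steps_std rtrancl_into_rtrancl)
qed

lemma std_absorbs_oplus_root:
  assumes "oplus_root \<subseteq> R"
  shows "std R O oplus_root \<subseteq> std R"
proof (rule subrelI)
  fix m u
  assume "(m, u) \<in> std R O oplus_root"
  then obtain p' q' where "(m, App (App Oplus p') q') \<in> std R" and u: "u = p' \<or> u = q'"
    by (auto elim: oplus_root.cases)
  from this(1) obtain p q where redex: "(m, App (App Oplus p) q) \<in> (weak_head_closure R)\<^sup>*"
    and "(p, p') \<in> std R" "(q, q') \<in> std R"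
    by (rule std_oplus_redexE)
  moreover have "(App (App Oplus p) q, p) \<in> weak_head_closure R"
    and "(App (App Oplus p) q, q) \<in> weak_head_closure R"
    using assms by (auto intro: root_in_weak_head_closure oplus_root.intros)
  ultimately show "(m, u) \<in> std R"
    using u by (blast intro: weak_head_steps_std rtrancl_into_rtrancl)
qed

lemma std_absorbs_ctx_closure:
  assumes "std R O S \<subseteq> std R"
  shows "std R O ctx_closure S \<subseteq> std R"
proof -
  have "(m, plug C r') \<in> std R" if "(m, plug C r) \<in> std R" "(r, r') \<in> S" for m C r r'
    using that assms by (induction C arbitrary: m) (auto elim!: std_LamE std_AppE intro: std.intros)
  then show ?thesis
    by (auto simp: ctx_closure_def elim!: closure_underE)
qed

lemma ctx_steps_subset_std:
  assumes "std R O R \<subseteq> std R"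
  shows "(ctx_closure R)\<^sup>* \<subseteq> std R"
proof (rule subrelI)
  fix m n
  assume "(m, n) \<in> (ctx_closure R)\<^sup>*"
  then show "(m, n) \<in> std R"
  proof induction
    case base
    show ?case by (rule std_refl)
  next
    case (step y z)
    then show ?case using std_absorbs_ctx_closure[OF assms] by blast
  qed
qed

section \<open>Factorization\<close>

lemma std_subset_weak_head_factorization:
  "std R \<subseteq> (weak_head_closure R)\<^sup>* O (nonweak_head_closure R)\<^sup>*"
proof (rule subrelI)
  let ?w = "weak_head_closure R" and ?n = "nonweak_head_closure R"
  fix m n
  assume "(m, n) \<in> std R"
  then show "(m, n) \<in> ?w\<^sup>* O ?n\<^sup>*"
  proof induction
    case (std_Lam m p p')
    then have "(Lam p, Lam p') \<in> ?n\<^sup>*"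
      by (intro nonweak_head_steps_Lam subsetD[OF weak_head_nonweak_head_steps_subset_ctx_steps])
    with std_Lam.hyps(1) show ?case by (rule relcompI)
  next
    case (std_App m p q p' q')
    obtain k where "(p, k) \<in> ?w\<^sup>*" and "(k, p') \<in> ?n\<^sup>*"
      using std_App.IH(1) by (rule relcompE) simp
    then have "(App p q, App k q) \<in> ?w\<^sup>*" "(App k q, App p' q) \<in> ?n\<^sup>*"
      by (simp_all add: weak_head_steps_AppL nonweak_head_steps_AppL)
    moreover have "(App p' q, App p' q') \<in> ?n\<^sup>*"
      using std_App.IH(2)
      by (intro nonweak_head_steps_AppR subsetD[OF weak_head_nonweak_head_steps_subset_ctx_steps])
    ultimately show ?case
      using std_App.hyps(1) by (meson relcompI rtrancl_trans)
  qed auto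
qed

lemma nonweak_head_step_imp_nonhead_step:
  assumes "(m, n) \<in> nonweak_head_closure R" and "\<nexists>p. n = Lam p"
  shows "(m, n) \<in> nonhead_closure R" and "\<nexists>p. m = Lam p"
proof -
  from assms(1) obtain C r r' where plug: "m = plug C r" "n = plug C r'"
    and nonweak: "\<not> weak_head_ctx C" and root: "(r, r') \<in> R"
    unfolding nonweak_head_closure_def by (rule closure_underE)
  from plug nonweak assms(2) have "\<not> head_ctx C"
    by (cases C) auto
  with plug root show "(m, n) \<in> nonhead_closure R"
    by (simp add: nonhead_closure_def closure_underI)
  from plug nonweak assms(2) show "\<nexists>p. m = Lam p"
    by (cases C) auto
qed

lemma nonweak_head_steps_imp_nonhead_steps:
  assumes "(m, n) \<in> (nonweak_head_closure R)\<^sup>*" and "\<nexists>p. n = Lam p"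
  shows "(m, n) \<in> (nonhead_closure R)\<^sup>*"
proof -
  have "(m, n) \<in> (nonhead_closure R)\<^sup>* \<and> (\<nexists>p. m = Lam p)"
    using assms(1)
  proof (induction rule: converse_rtrancl_induct)
    case base
    then show ?case using assms(2) by simp
  next
    case (step l m)
    then show ?case
      using nonweak_head_step_imp_nonhead_step[of l m R]
      by (auto intro: converse_rtrancl_into_rtrancl)
  qed
  then show ?thesis ..
qed

lemma std_head_factorization_if_not_Lam:
  assumes "(m, n) \<in> std R" and "\<nexists>p. n = Lam p"
  shows "(m, n) \<in> (head_closure R)\<^sup>* O (nonhead_closure R)\<^sup>*"
proof -
  from assms(1) obtain k where "(m, k) \<in> (weak_head_closure R)\<^sup>*"
    and "(k, n) \<in> (nonweak_head_closure R)\<^sup>*"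
    using std_subset_weak_head_factorization by blast
  with assms(2) show ?thesis
    using rtrancl_mono[OF weak_head_closure_subset_head_closure]
    by (blast intro: nonweak_head_steps_imp_nonhead_steps)
qed

lemma std_subset_head_factorization: "std R \<subseteq> (head_closure R)\<^sup>* O (nonhead_closure R)\<^sup>*"
proof (rule subrelI)
  let ?h = "head_closure R" and ?n = "nonhead_closure R"
  fix m n
  assume "(m, n) \<in> std R"
  then show "(m, n) \<in> ?h\<^sup>* O ?n\<^sup>*"
  proof (induction n arbitrary: m rule: trm.induct)
    case (Lam p')
    from Lam.prems obtain p where head_steps: "(m, Lam p) \<in> ?h\<^sup>*" and "(p, p') \<in> std R"
      using rtrancl_mono[OF weak_head_closure_subset_head_closure] by (blast elim: std_LamE)
    with Lam.IH obtain k where "(p, k) \<in> ?h\<^sup>*" "(k, p') \<in> ?n\<^sup>*"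
      by blast
    then have "(Lam p, Lam k) \<in> ?h\<^sup>*" "(Lam k, Lam p') \<in> ?n\<^sup>*"
      by (simp_all add: head_steps_Lam nonhead_steps_Lam)
    with head_steps show ?case by (meson relcompI rtrancl_trans)
  qed (auto dest!: std_head_factorization_if_not_Lam)
qed

lemma head_factorization_if_std_absorbs:
  assumes "std R O R \<subseteq> std R"
  shows "(ctx_closure R)\<^sup>* \<subseteq> (head_closure R)\<^sup>* O (nonhead_closure R)\<^sup>*"
  using ctx_steps_subset_std[OF assms] std_subset_head_factorization by (rule subset_trans)

lemma head_factorization_oplus:
  "(ctx_closure oplus_root)\<^sup>* \<subseteq> (head_closure oplus_root)\<^sup>* O (nonhead_closure oplus_root)\<^sup>*"
  by (intro head_factorization_if_std_absorbs std_absorbs_oplus_root subset_refl)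

lemma head_factorization_beta_oplus:
  "(ctx_closure beta_root \<union> ctx_closure oplus_root)\<^sup>*
    \<subseteq> (head_closure beta_root \<union> head_closure oplus_root)\<^sup>*
      O (nonhead_closure beta_root \<union> nonhead_closure oplus_root)\<^sup>*"
proof -
  let ?R = "beta_root \<union> oplus_root"
  have "subst_closed ?R"
    by (intro subst_closed_Un subst_closed_beta_root subst_closed_oplus_root)
  then have "std ?R O ?R \<subseteq> std ?R"
    by (simp add: std_absorbs_beta_root std_absorbs_oplus_root)
  then have "(ctx_closure ?R)\<^sup>* \<subseteq> (head_closure ?R)\<^sup>* O (nonhead_closure ?R)\<^sup>*"
    by (rule head_factorization_if_std_absorbs)
  then show ?thesis
    by (simp add: ctx_closure_def head_closure_def nonhead_closure_def closure_under_Un)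
qed

section \<open>Non-head steps before a root \<open>\<oplus>\<close>-step\<close>

lemma not_nonweak_head_step_Oplus: "(m, Oplus) \<notin> nonweak_head_closure R"
proof
  assume "(m, Oplus) \<in> nonweak_head_closure R"
  then obtain C r' where "Oplus = plug C r'" "\<not> weak_head_ctx C"
    unfolding nonweak_head_closure_def by (rule closure_underE)
  then show False by (cases C) auto
qed

lemma nonweak_head_step_AppE:
  assumes "(m, App t u) \<in> nonweak_head_closure R"
  obtains (fun_step) t' where "m = App t' u" "(t', t) \<in> nonweak_head_closure R"
  | (arg_step) u' where "m = App t u'" "(u', u) \<in> ctx_closure R"
proof -
  from assms obtain C r r' where plug: "m = plug C r" "App t u = plug C r'"
    and nonweak: "\<not> weak_head_ctx C" and root: "(r, r') \<in> R"
    unfolding nonweak_head_closure_def by (rule closure_underE)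
  show thesis
  proof (cases C)
    case (CAppL D u)
    with plug nonweak root show thesis
      by (intro fun_step) (auto simp: nonweak_head_closure_def intro: closure_underI)
  next
    case (CAppR t D)
    with plug root show thesis
      by (intro arg_step) (auto simp: ctx_closure_def intro: closure_underI)
  qed (use plug nonweak in auto)
qed

lemma nonweak_head_step_oplus_redexE:
  assumes "(m, App (App Oplus t) p) \<in> nonweak_head_closure R"
  obtains t' p' where "m = App (App Oplus t') p'"
    "(t', t) \<in> (ctx_closure R)\<^sup>=" "(p', p) \<in> (ctx_closure R)\<^sup>="
  using assms
proof (cases rule: nonweak_head_step_AppE)
  case (fun_step m')
  from fun_step(2) show thesis
    by (cases rule: nonweak_head_step_AppE)
      (use that fun_step(1) not_nonweak_head_step_Oplus in auto)
next
  case (arg_step p')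
  with that show thesis by blast
qed

lemma nonhead_step_oplus_root_subset:
  "nonhead_closure R O oplus_root \<subseteq> head_closure oplus_root O (ctx_closure R)\<^sup>="
proof (rule subrelI)
  fix m n
  assume "(m, n) \<in> nonhead_closure R O oplus_root"
  then obtain t p where "(m, App (App Oplus t) p) \<in> nonweak_head_closure R" and n: "n = t \<or> n = p"
    using nonhead_closure_subset_nonweak_head_closure by (blast elim: oplus_root.cases)
  from this(1) obtain t' p' where m: "m = App (App Oplus t') p'"
    and "(t', t) \<in> (ctx_closure R)\<^sup>=" "(p', p) \<in> (ctx_closure R)\<^sup>="
    by (rule nonweak_head_step_oplus_redexE)
  moreover have "(m, t') \<in> head_closure oplus_root" "(m, p') \<in> head_closure oplus_root"
    unfolding m head_closure_def by (auto intro: root_in_closure_under oplus_root.intros)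
  ultimately show "(m, n) \<in> head_closure oplus_root O (ctx_closure R)\<^sup>="
    using n by blast
qed

theorem theorem5p3:
  shows "(ctx_closure oplus_root)\<^sup>* \<subseteq> (head_closure oplus_root)\<^sup>* O (nonhead_closure oplus_root)\<^sup>* \<and>
    nonhead_closure beta_root O oplus_root \<subseteq> head_closure oplus_root O (ctx_closure beta_root)\<^sup>= \<and>
    substitutive oplus_root \<and>
    (ctx_closure beta_root \<union> ctx_closure oplus_root)\<^sup>*
      \<subseteq> (head_closure beta_root \<union> head_closure oplus_root)\<^sup>*
        O (nonhead_closure beta_root \<union> nonhead_closure oplus_root)\<^sup>*"
  by (intro conjI head_factorization_oplus nonhead_step_oplus_root_subset
      subst_closed_imp_substitutive subst_closed_oplus_root head_factorization_beta_oplus)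

end
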